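(* Let $D_n$ and $D_m$ denote the dihedral groups of orders $2n$ and $2m$. The difference graph $D(D_n\times D_m)$ is disconnected if and only if $n$ and $m$ are powers of the same odd prime.
   Context: For a group $G$, the power graph $\mathsf{Pow}(G)$ has vertex set $G$, with distinct $a,b$ adjacent iff $a\in\langle b\rangle$ or $b\in\langle a\rangle$. The enhanced power graph $\mathsf{EPow}(G)$ has vertex set $G$, with distinct $a,b$ adjacent iff $\langle a,b\rangle$ is cyclic. The difference graph $D(G)$ is the graph $\mathsf{EPow}(G)-\mathsf{Pow}(G)$ with all isolated vertices removed; thus $x\sim y$ in $D(G)$ iff $\langle x,y\rangle$ is cyclic, $x\notin\langle y\rangle$ and $y\notin\langle x\rangle$. *)

theory Defs
  imports
    "HOL-Algebra.Elementary_Groups"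
    "HOL-Algebra.Coset"
    "HOL-Computational_Algebra.Primes"
    "Graph_Theory.Digraph_Component"
begin

section \<open>Dihedral groups\<close>

text \<open>
  The dihedral group of order \<open>2 * n\<close>, for \<open>n \<ge> 1\<close>. With a rotation \<open>r\<close> of order \<open>n\<close> and a
  reflection \<open>s\<close>, the pair \<open>(i, e)\<close> stands for \<open>r ^ i\<close> if \<open>e\<close> is false and for \<open>r ^ i * s\<close> if
  \<open>e\<close> is true; the multiplication is determined by \<open>s * r = inverse r * s\<close> and \<open>s * s = 1\<close>.
\<close>
definition dihedral :: "nat \<Rightarrow> (int \<times> bool) monoid" where
  "dihedral n =
    \<lparr>carrier = {0..<int n} \<times> UNIV,
     monoid.mult = (\<lambda>(i, e) (j, f). ((if e then i - j else i + j) mod int n, e \<noteq> f)),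
     one = (0, False)\<rparr>"

lemma group_dihedral:
  assumes "n \<ge> 1"
  shows "group (dihedral n)"
proof (rule groupI)
  fix x assume "x \<in> carrier (dihedral n)"
  then obtain i e where x: "x = (i, e)" "0 \<le> i" "i < int n"
    by (auto simp: dihedral_def)
  have "(if e then (i, True) else ((- i) mod int n, False)) \<in> carrier (dihedral n)"
    using x assms by (auto simp: dihedral_def)
  moreover have "(if e then (i, True) else ((- i) mod int n, False)) \<otimes>\<^bsub>dihedral n\<^esub> x = \<one>\<^bsub>dihedral n\<^esub>"
    using x by (auto simp: dihedral_def mod_simps)
  ultimately show "\<exists>y\<in>carrier (dihedral n). y \<otimes>\<^bsub>dihedral n\<^esub> x = \<one>\<^bsub>dihedral n\<^esub>"
    by blast
qed (use assms in \<open>auto simp: dihedral_def mod_simps algebra_simps\<close>)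

lemma order_dihedral: "order (dihedral n) = 2 * n"
  by (simp add: order_def dihedral_def card_cartesian_product)

section \<open>The difference graph of a group\<close>

text \<open>
  A simple undirected graph is represented by a symmetric, irreflexive digraph, as in the locale
  \<^locale>\<open>graph\<close>.
\<close>

definition power_graph :: "('a, 'b) monoid_scheme \<Rightarrow> 'a pair_pre_digraph" where
  "power_graph G =
    \<lparr>pverts = carrier G,
     parcs = {(a, b). a \<in> carrier G \<and> b \<in> carrier G \<and> a \<noteq> b \<and>
                      (a \<in> generate G {b} \<or> b \<in> generate G {a})}\<rparr>"

definition enhanced_power_graph :: "('a, 'b) monoid_scheme \<Rightarrow> 'a pair_pre_digraph" where
  "enhanced_power_graph G =
    \<lparr>pverts = carrier G,
     parcs = {(a, b). a \<in> carrier G \<and> b \<in> carrier G \<and> a \<noteq> b \<and>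
                      cyclic_group (subgroup_generated G {a, b})}\<rparr>"

definition delete_edges :: "'a pair_pre_digraph \<Rightarrow> 'a pair_pre_digraph \<Rightarrow> 'a pair_pre_digraph" where
  "delete_edges H K = \<lparr>pverts = pverts H, parcs = parcs H - parcs K\<rparr>"

definition remove_isolated :: "'a pair_pre_digraph \<Rightarrow> 'a pair_pre_digraph" where
  "remove_isolated H =
    \<lparr>pverts = {v \<in> pverts H. \<exists>w \<in> pverts H. (v, w) \<in> parcs H \<or> (w, v) \<in> parcs H},
     parcs = parcs H\<rparr>"

definition difference_graph :: "('a, 'b) monoid_scheme \<Rightarrow> 'a pair_pre_digraph" where
  "difference_graph G =
    remove_isolated (delete_edges (enhanced_power_graph G) (power_graph G))"

text \<open>
  The library's \<^const>\<open>connected\<close> is false for the graph without vertices. That graph, which is the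
  difference graph of every finite \<open>p\<close>-group, does not count as disconnected.
\<close>
definition disconnected :: "'a pair_pre_digraph \<Rightarrow> bool" where
  "disconnected H \<longleftrightarrow> pverts H \<noteq> {} \<and> \<not> connected H"

lemma graph_difference_graph:
  assumes "finite (carrier G)"
  shows "graph (difference_graph G)"
proof -
  let ?D = "with_proj (difference_graph G)"
  have sub: "parcs (difference_graph G) \<subseteq> carrier G \<times> carrier G"
    by (auto simp: difference_graph_def remove_isolated_def delete_edges_def
        enhanced_power_graph_def)
  have fin: "finite (pverts (difference_graph G))" "finite (parcs (difference_graph G))"
    using assms finite_subset[OF sub]
    by (auto simp: difference_graph_def remove_isolated_def delete_edges_def
        enhanced_power_graph_def)
  have "symmetric ?D"
    by (auto simp: symmetric_def sym_def difference_graph_def remove_isolated_def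
        delete_edges_def enhanced_power_graph_def power_graph_def insert_commute)
  then show ?thesis
    using fin
    by unfold_locales
      (auto simp: difference_graph_def remove_isolated_def delete_edges_def
        enhanced_power_graph_def arc_to_ends_def)
qed

lemma adjacent_difference_graph_iff:
  "(x, y) \<in> parcs (difference_graph G) \<longleftrightarrow>
    x \<in> carrier G \<and> y \<in> carrier G \<and> cyclic_group (subgroup_generated G {x, y}) \<and>
    x \<notin> generate G {y} \<and> y \<notin> generate G {x}"
  by (auto simp: difference_graph_def remove_isolated_def delete_edges_def
      enhanced_power_graph_def power_graph_def intro: generate.incl)

end

theory Submission
  imports Defs "HOL-Algebra.Multiplicative_Group"
begin

text \<open>
  In a finite group, \<open>x\<close> and \<open>y\<close> are adjacent iff they lie in a common cyclic subgroup and neither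
  order divides the other. Hence an edge at \<open>x\<close> involves two distinct primes, and \<open>x\<close> is joined by a
  path to elements of both of these prime orders, one of which is odd. So the graph is connected or
  empty as soon as the elements of odd prime order lie in one component. In \<open>D\<^sub>n \<times> D\<^sub>m\<close> such elements
  are pairs of rotations and commute, so this holds if two odd primes divide \<open>n * m\<close>, and also if
  there is a central involution, that is, if \<open>n\<close> or \<open>m\<close> is \<open>1\<close> or even. What remains is the case of
  powers of one odd prime. There every edge lies in a cyclic group generated by a pair of a
  reflection and a rotation, in this order or the reverse, and no edge joins the two kinds.
\<close>

section \<open>Edges and reachability in the difference graph\<close>

lemma sym_difference_graph: "sym (parcs (difference_graph G))"
  by (auto simp: sym_def adjacent_difference_graph_iff insert_commute)

lemma vertex_difference_graph_iff:
  "v \<in> pverts (difference_graph G) \<longleftrightarrow> (\<exists>w. (v, w) \<in> parcs (difference_graph G))"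
  by (auto simp: difference_graph_def remove_isolated_def delete_edges_def
      enhanced_power_graph_def power_graph_def insert_commute)

text \<open>The edge relation is its own symmetric closure and endpoints of edges are vertices, so
  reachability within the vertex set is plain \<open>rtrancl\<close>. The empty graph fails both
  sides.\<close>

lemma disconnected_difference_graph_iff:
  assumes "finite (carrier G)"
  shows "disconnected (difference_graph G) \<longleftrightarrow>
    (\<exists>u \<in> pverts (difference_graph G). \<exists>v \<in> pverts (difference_graph G).
      (u, v) \<notin> (parcs (difference_graph G))\<^sup>*)"
proof -
  let ?D = "difference_graph G"
  interpret graph "with_proj ?D"
    using assms by (rule graph_difference_graph)
  have sym: "(parcs ?D)\<^sup>s = parcs ?D"
    using sym_difference_graph[of G] by (auto simp: symcl_def sym_def)
  have "(u, v) \<in> rtrancl_on (pverts ?D) (parcs ?D) \<longleftrightarrow> (u, v) \<in> (parcs ?D)\<^sup>*"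
    if "u \<in> pverts ?D" for u v
  proof
    show "(u, v) \<in> rtrancl_on (pverts ?D) (parcs ?D) \<Longrightarrow> (u, v) \<in> (parcs ?D)\<^sup>*"
      by (rule rtrancl_on_rtranclI)
    assume "(u, v) \<in> (parcs ?D)\<^sup>*"
    then show "(u, v) \<in> rtrancl_on (pverts ?D) (parcs ?D)"
    proof (induction rule: rtrancl_induct)
      case base
      then show ?case using that by simp
    next
      case (step y z)
      then show ?case
        using sym_difference_graph[of G]
        by (meson rtrancl_on_into_rtrancl_on symD vertex_difference_graph_iff)
    qed
  qed
  then show ?thesis
    unfolding disconnected_def connected_conv with_proj_simps sym by blast
qed

section \<open>Divisibility and prime powers\<close>

lemma exists_prime_power_dvd_not_dvd:
  fixes a b :: nat
  assumes "\<not> a dvd b" "a > 0"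
  obtains p k where "prime p" "p ^ k dvd a" "\<not> p ^ k dvd b"
proof -
  have "b \<noteq> 0" using assms by (metis dvd_0_right)
  then obtain p where "prime p" "multiplicity p a > multiplicity p b"
    using multiplicity_le_imp_dvd[of a b] assms by (metis not_le neq0_conv)
  moreover from this \<open>b \<noteq> 0\<close> have "\<not> p ^ multiplicity p a dvd b"
    by (metis leD not_prime_unit power_dvd_iff_le_multiplicity prime_gt_0_nat)
  ultimately show ?thesis
    using that multiplicity_dvd by blast
qed

lemma primepow_divisors_comparable:
  fixes p x y :: nat
  assumes "prime p" "x dvd p ^ c" "y dvd p ^ c"
  shows "x dvd y \<or> y dvd x"
  using assms by (metis divides_primepow_nat le_imp_power_dvd nle_le)

section \<open>Adjacency in terms of element orders\<close>

context group
begin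

text \<open>Cyclicity passes to subgroups: for \<open>x = z^a\<close> and \<open>y = z^b\<close>,
  Bezout makes \<open>z^(gcd a b)\<close> a generator of the subgroup spanned by both.\<close>

lemma cyclic_pair_iff:
  assumes x: "x \<in> carrier G" and y: "y \<in> carrier G"
  shows "cyclic_group (subgroup_generated G {x, y}) \<longleftrightarrow>
    (\<exists>z \<in> carrier G. x \<in> generate G {z} \<and> y \<in> generate G {z})"
proof
  let ?H = "subgroup_generated G {x, y}"
  interpret H: group ?H by simp
  assume "cyclic_group ?H"
  then obtain z where z: "z \<in> carrier ?H" and eq: "carrier ?H = range (\<lambda>n::int. z [^]\<^bsub>?H\<^esub> n)"
    using H.cyclic_group by blast
  have zG: "z \<in> carrier G"
    using z carrier_subgroup_generated_subset by blast
  have "carrier ?H = generate G {z}"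
    unfolding eq generate_pow[OF zG] using z by (auto simp: int_pow_subgroup_generated)
  moreover have "x \<in> carrier ?H" "y \<in> carrier ?H"
    using x y by (auto simp: carrier_subgroup_generated intro: generate.incl)
  ultimately show "\<exists>z \<in> carrier G. x \<in> generate G {z} \<and> y \<in> generate G {z}"
    using zG by blast
next
  assume "\<exists>z \<in> carrier G. x \<in> generate G {z} \<and> y \<in> generate G {z}"
  then obtain z a b where z: "z \<in> carrier G" and a: "x = z [^] (a::int)" and b: "y = z [^] (b::int)"
    by (auto simp: generate_pow)
  obtain s t where "s * a + t * b = gcd a b"
    using bezout_int by blast
  define d where "d = z [^] gcd a b"
  have d: "d \<in> carrier G" using z by (simp add: d_def)
  have d_eq: "d = x [^] s \<otimes> y [^] t"
    unfolding d_def \<open>_ = gcd a b\<close>[symmetric] a b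
    using z by (simp add: int_pow_mult int_pow_pow mult.commute)
  have "generate G {x, y} = generate G {d}"
  proof
    have "x = d [^] (a div gcd a b)" "y = d [^] (b div gcd a b)"
      using z by (simp_all add: d_def a b int_pow_pow)
    then have "x \<in> generate G {d}" "y \<in> generate G {d}"
      using d by (auto simp: generate_pow)
    then show "generate G {x, y} \<subseteq> generate G {d}"
      using d by (intro generate_subgroup_incl generate_is_subgroup) auto
    have "subgroup (generate G {x, y}) G"
      using x y by (intro generate_is_subgroup) auto
    then have "d \<in> generate G {x, y}"
      unfolding d_eq
      by (intro subgroup.m_closed subgroup_int_pow_closed) (auto intro: generate.incl)
    then show "generate G {d} \<subseteq> generate G {x, y}"
      using x y by (intro generate_subgroup_incl generate_is_subgroup) auto
  qed
  then have "subgroup_generated G {x, y} = subgroup_generated G {d}"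
    using x y d by (simp add: subgroup_generated_def)
  then show "cyclic_group (subgroup_generated G {x, y})"
    using cyclic_group_generated by metis
qed

lemma nat_pow_in_generate:
  assumes "z \<in> carrier G"
  shows "z [^] (k::nat) \<in> generate G {z}"
  unfolding generate_pow[OF assms] using assms by (auto intro: exI[of _ "int k"] simp: int_pow_int)

lemma generate_trans:
  assumes "y \<in> generate G {z}" "x \<in> generate G {y}" "z \<in> carrier G"
  shows "x \<in> generate G {z}"
  using assms generate_subgroup_incl[of "{y}" "generate G {z}"] generate_is_subgroup[of "{z}"]
  by auto

lemma ord_dvd_of_in_generate:
  assumes "x \<in> generate G {y}" "y \<in> carrier G"
  shows "ord x dvd ord y"
proof -
  obtain k where k: "x = y [^] (k::int)"
    using assms by (auto simp: generate_pow)
  have "x [^] int (ord y) = (y [^] int (ord y)) [^] k"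
    using assms by (simp add: k int_pow_pow mult.commute)
  also have "\<dots> = \<one>"
    using assms by (simp add: int_pow_int)
  finally show ?thesis
    using assms by (simp add: k int_pow_int pow_eq_id)
qed

text \<open>Inclusion between subgroups of a finite cyclic group is divisibility of orders. With
  \<open>x = z^a\<close> and \<open>y = z^b\<close>, the hypothesis forces
  \<open>gcd (ord z) b\<close> to divide \<open>a\<close>, so \<open>a\<close> is a multiple of
  \<open>b\<close> modulo \<open>ord z\<close>.\<close>

lemma in_generate_if_ord_dvd:
  assumes fin: "finite (carrier G)" and z: "z \<in> carrier G"
    and x: "x \<in> generate G {z}" and y: "y \<in> generate G {z}" and dvd: "ord x dvd ord y"
  shows "x \<in> generate G {y}"
proof -
  have N: "ord z > 0"
    using ord_ge_1[OF fin z] by simp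
  obtain a b where a: "x = z [^] (a::nat)" and b: "y = z [^] (b::nat)"
    using x y N by (auto simp: generate_pow_nat[OF z])
  have "ord y = ord z div gcd (ord z) b"
    using N by (simp add: b ord_pow_gen z)
  moreover have "z [^] (a * ord y) = \<one>"
    using dvd z by (simp add: a pow_eq_id flip: nat_pow_pow)
  ultimately have "ord z dvd a * (ord z div gcd (ord z) b)"
    by (simp add: pow_eq_id z)
  then have "gcd (ord z) b * (ord z div gcd (ord z) b) dvd a * (ord z div gcd (ord z) b)"
    by simp
  moreover have "ord z div gcd (ord z) b \<noteq> 0"
    using N by (simp add: dvd_div_eq_0_iff)
  ultimately have "gcd (ord z) b dvd a"
    by (metis dvd_times_right_cancel_iff)
  then obtain c where c: "a = gcd (ord z) b * c" ..
  obtain s t where st: "s * int (ord z) + t * int b = gcd (int (ord z)) (int b)"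
    using bezout_int by blast
  \<comment> \<open>The Bezout identity multiplied by \<open>c\<close>; the summand divisible by
    \<open>ord z\<close> vanishes in the exponent.\<close>
  have "int a = int b * (t * int c) + int (ord z) * (s * int c)"
    unfolding c by (simp add: st[symmetric] algebra_simps flip: gcd_int_int_eq)
  then have "x = z [^] (int b * (t * int c)) \<otimes> z [^] (int (ord z) * (s * int c))"
    using z by (metis a int_pow_int int_pow_mult)
  also have "z [^] (int (ord z) * (s * int c)) = \<one>"
    using z by (simp add: int_pow_eq_id)
  also have "z [^] (int b * (t * int c)) = y [^] (t * int c)"
    using z by (simp add: b int_pow_int flip: int_pow_pow)
  finally have "x = y [^] (t * int c)"
    using z b by simp
  then show ?thesis
    using z b by (auto simp: generate_pow)
qed

text \<open>Inside the cyclic group of \<open>z\<close>, lying in the subgroup generated by an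
  element is the same as having an order that divides its order.\<close>

lemma adjacent_iff_ord:
  assumes "finite (carrier G)"
  shows "(x, y) \<in> parcs (difference_graph G) \<longleftrightarrow>
    (\<exists>z \<in> carrier G. x \<in> generate G {z} \<and> y \<in> generate G {z} \<and>
      \<not> ord x dvd ord y \<and> \<not> ord y dvd ord x)"
    (is "?L \<longleftrightarrow> ?R")
proof
  assume ?L
  then show ?R
    unfolding adjacent_difference_graph_iff
    using cyclic_pair_iff in_generate_if_ord_dvd[OF assms] by metis
next
  assume ?R
  then obtain z where z: "z \<in> carrier G" "x \<in> generate G {z}" "y \<in> generate G {z}"
    "\<not> ord x dvd ord y" "\<not> ord y dvd ord x"
    by blast
  moreover have "x \<in> carrier G" "y \<in> carrier G"
    using z generate_in_carrier[of "{z}"] by auto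
  ultimately show ?L
    unfolding adjacent_difference_graph_iff
    using cyclic_pair_iff ord_dvd_of_in_generate by blast
qed

lemma adjacent_if_coprime_ord:
  assumes fin: "finite (carrier G)" and x: "x \<in> carrier G" and y: "y \<in> carrier G"
    and comm: "x \<otimes> y = y \<otimes> x" and cop: "coprime (ord x) (ord y)"
    and x1: "x \<noteq> \<one>" and y1: "y \<noteq> \<one>"
  shows "(x, y) \<in> parcs (difference_graph G)"
proof -
  \<comment> \<open>Raising \<open>u \<otimes> v\<close> to the power \<open>ord v\<close> kills
    \<open>v\<close>; as \<open>ord v\<close> is coprime to \<open>ord u\<close>, the remaining
    power of \<open>u\<close> still generates \<open>u\<close>.\<close>
  have *: "u \<in> generate G {u \<otimes> v}"
    if "u \<in> carrier G" "v \<in> carrier G" "u \<otimes> v = v \<otimes> u" "coprime (ord u) (ord v)" for u v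
  proof -
    have "ord v > 0"
      using ord_ge_1[OF fin that(2)] by simp
    then have "ord (u [^] ord v) = ord u"
      using that by (simp add: ord_pow_gen)
    then have "u \<in> generate G {u [^] ord v}"
      using in_generate_if_ord_dvd[OF fin that(1) _ nat_pow_in_generate[OF that(1)]]
      by (simp add: generate.incl)
    moreover have "(u \<otimes> v) [^] ord v = u [^] ord v"
      using that by (simp add: pow_mult_distrib)
    ultimately show ?thesis
      using that nat_pow_in_generate[of "u \<otimes> v" "ord v"] by (metis generate_trans m_closed)
  qed
  have "x \<in> generate G {x \<otimes> y}" "y \<in> generate G {x \<otimes> y}"
    using *[of x y] *[of y x] x y comm cop by (auto simp: coprime_commute)
  moreover have "ord x \<noteq> 1" "ord y \<noteq> 1"
    using x y x1 y1 ord_eq_1 by auto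
  then have "\<not> ord x dvd ord y" "\<not> ord y dvd ord x"
    using cop by (auto dest: coprime_absorb_left coprime_absorb_right)
  ultimately show ?thesis
    unfolding adjacent_iff_ord[OF fin] using x y by blast
qed

section \<open>Paths to elements of prime order, and criteria for connectedness\<close>

lemma adjacent_reaches_prime_orders:
  assumes fin: "finite (carrier G)" and xy: "(x, y) \<in> parcs (difference_graph G)"
  obtains p q w u where "prime p" "prime q" "p \<noteq> q" "w \<in> carrier G" "u \<in> carrier G"
    "ord w = p" "ord u = q"
    "(x, w) \<in> (parcs (difference_graph G))\<^sup>*" "(x, u) \<in> (parcs (difference_graph G))\<^sup>*"
proof -
  obtain z where z: "z \<in> carrier G" and x: "x \<in> generate G {z}" and y: "y \<in> generate G {z}"
    and nxy: "\<not> ord x dvd ord y" "\<not> ord y dvd ord x"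
    using xy adjacent_iff_ord[OF fin] by blast
  have xG: "x \<in> carrier G" and yG: "y \<in> carrier G"
    using x y z generate_in_carrier[of "{z}"] by auto
  have o: "ord x > 0" "ord y > 0"
    using ord_ge_1[OF fin xG] ord_ge_1[OF fin yG] by auto
  obtain p k where p: "prime p" "p ^ k dvd ord x" "\<not> p ^ k dvd ord y"
    using exists_prime_power_dvd_not_dvd[OF nxy(1) o(1)] .
  obtain q l where q: "prime q" "q ^ l dvd ord y" "\<not> q ^ l dvd ord x"
    using exists_prime_power_dvd_not_dvd[OF nxy(2) o(2)] .
  \<comment> \<open>For equal primes one of \<open>p ^ k\<close> and \<open>q ^ l\<close> would
    divide the other, and hence the order it was chosen not to divide.\<close>
  have neq: "p \<noteq> q"
    using p q by (metis dvd_trans le_imp_power_dvd nle_le)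
  have "k \<noteq> 0" "l \<noteq> 0"
    using p q by (metis one_dvd power_0)+
  then have px: "p dvd ord x" and qy: "q dvd ord y" and ql: "q dvd q ^ l"
    using p q by (metis dvd_power dvd_trans gr0I)+
  have exists_ord: "\<exists>v \<in> generate G {g}. ord v = d"
    if "g \<in> carrier G" "d dvd ord g" for g d
  proof (intro bexI)
    have "ord g > 0"
      using ord_ge_1[OF fin that(1)] by simp
    then have "ord g div d dvd ord g" "ord g div d \<noteq> 0" "ord g div (ord g div d) = d"
      using that by (auto simp: div_dvd_iff_mult dvd_div_eq_0_iff elim!: dvdE)
    then show "ord (g [^] (ord g div d)) = d"
      using that by (simp add: ord_pow)
    show "g [^] (ord g div d) \<in> generate G {g}"
      using that by (intro nat_pow_in_generate)
  qed
  obtain w where w: "w \<in> generate G {x}" "ord w = p"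
    using exists_ord[OF xG px] by blast
  obtain v where v: "v \<in> generate G {y}" "ord v = q ^ l"
    using exists_ord[OF yG q(2)] by blast
  obtain u where u: "u \<in> generate G {y}" "ord u = q"
    using exists_ord[OF yG qy] by blast
  have gens: "w \<in> generate G {z}" "v \<in> generate G {z}" "u \<in> generate G {z}"
    using generate_trans z x y w v u by blast+
  then have wuG: "w \<in> carrier G" "u \<in> carrier G"
    using z generate_in_carrier[of "{z}"] by auto
  have pq: "\<not> p dvd q" "\<not> q dvd p" "\<not> p dvd q ^ l" "\<not> q ^ l dvd p"
    using p(1) q(1) neq ql primes_dvd_imp_eq by (metis dvd_trans prime_dvd_power)+
  \<comment> \<open>The path is \<open>x \<sim> v \<sim> w \<sim> u\<close>. The \<open>q\<close>-part \<open>v\<close> of \<open>y\<close> is needed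
      because \<open>u\<close> may be a power of \<open>x\<close>.\<close>
  have "(x, v) \<in> parcs (difference_graph G)"
    unfolding adjacent_iff_ord[OF fin] using z x gens v q(3) px pq by (metis dvd_trans)
  moreover have "(v, w) \<in> parcs (difference_graph G)" "(w, u) \<in> parcs (difference_graph G)"
    unfolding adjacent_iff_ord[OF fin] using z gens v w u pq by metis+
  ultimately have "(x, w) \<in> (parcs (difference_graph G))\<^sup>*"
    "(x, u) \<in> (parcs (difference_graph G))\<^sup>*"
    by (meson converse_rtrancl_into_rtrancl rtrancl.rtrancl_refl)+
  then show ?thesis
    using that p q neq wuG w u by blast
qed

lemma not_disconnected_if_odd_prime_orders_connected:
  assumes fin: "finite (carrier G)"
    and conn: "\<And>v w. v \<in> carrier G \<Longrightarrow> w \<in> carrier G \<Longrightarrow> prime (ord v) \<Longrightarrow> prime (ord w) \<Longrightarrow>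
      odd (ord v) \<Longrightarrow> odd (ord w) \<Longrightarrow> (v, w) \<in> (parcs (difference_graph G))\<^sup>*"
  shows "\<not> disconnected (difference_graph G)"
proof -
  let ?E = "parcs (difference_graph G)"
  \<comment> \<open>Of the two distinct prime orders reached from \<open>x\<close>, at most one is
    2.\<close>
  have "\<exists>w \<in> carrier G. prime (ord w) \<and> odd (ord w) \<and> (x, w) \<in> ?E\<^sup>*"
    if "x \<in> pverts (difference_graph G)" for x
    using that unfolding vertex_difference_graph_iff
    by (metis fin adjacent_reaches_prime_orders primes_dvd_imp_eq two_is_prime_nat)
  moreover have "sym (?E\<^sup>*)"
    using sym_difference_graph by (rule sym_rtrancl)
  ultimately have "(x, y) \<in> ?E\<^sup>*"
    if "x \<in> pverts (difference_graph G)" "y \<in> pverts (difference_graph G)" for x y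
    using that conn by (meson rtrancl_trans symD)
  then show ?thesis
    using disconnected_difference_graph_iff[OF fin] by blast
qed

lemma ord_eq_prime:
  assumes "x \<in> carrier G" "prime p" "x [^] p = \<one>" "x \<noteq> \<one>"
  shows "ord x = p"
  using assms by (metis ord_eq_1 pow_eq_id prime_nat_iff)

text \<open>Such a \<open>c\<close> has order 2 and commutes with everything, so it is a common
  neighbour of all elements of odd prime order.\<close>

lemma not_disconnected_if_central_involution:
  assumes fin: "finite (carrier G)" and c: "c \<in> carrier G" "c \<noteq> \<one>" "c \<otimes> c = \<one>"
    and central: "\<And>x. x \<in> carrier G \<Longrightarrow> c \<otimes> x = x \<otimes> c"
  shows "\<not> disconnected (difference_graph G)"
proof (rule not_disconnected_if_odd_prime_orders_connected[OF fin])
  have "c [^] (2::nat) = \<one>"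
    using c by (simp add: numeral_2_eq_2)
  with c have "ord c = 2"
    by (intro ord_eq_prime) simp_all
  then have *: "(c, x) \<in> parcs (difference_graph G)"
    if "x \<in> carrier G" "prime (ord x)" "odd (ord x)" for x
    using that c(2) by (intro adjacent_if_coprime_ord[OF fin c(1) _ central]) auto
  fix v w assume "v \<in> carrier G" "w \<in> carrier G" "prime (ord v)" "prime (ord w)"
    "odd (ord v)" "odd (ord w)"
  then have "(v, c) \<in> parcs (difference_graph G)" "(c, w) \<in> parcs (difference_graph G)"
    using * sym_difference_graph[of G] by (auto dest: symD)
  then show "(v, w) \<in> (parcs (difference_graph G))\<^sup>*"
    by auto
qed

text \<open>Commuting elements of distinct prime orders are adjacent; two elements of the same odd
  prime order are joined through one of \<open>a\<close> and \<open>b\<close> whose order differs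
  from theirs.\<close>

lemma not_disconnected_if_two_odd_primes:
  assumes fin: "finite (carrier G)"
    and comm: "\<And>x y. x \<in> carrier G \<Longrightarrow> y \<in> carrier G \<Longrightarrow> odd (ord x) \<Longrightarrow> odd (ord y) \<Longrightarrow>
      x \<otimes> y = y \<otimes> x"
    and a: "a \<in> carrier G" "prime (ord a)" "odd (ord a)"
    and b: "b \<in> carrier G" "prime (ord b)" "odd (ord b)"
    and ne: "ord a \<noteq> ord b"
  shows "\<not> disconnected (difference_graph G)"
proof (rule not_disconnected_if_odd_prime_orders_connected[OF fin])
  have *: "(x, y) \<in> parcs (difference_graph G)"
    if "x \<in> carrier G" "prime (ord x)" "odd (ord x)" "y \<in> carrier G" "prime (ord y)" "odd (ord y)"
      "ord x \<noteq> ord y" for x y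
    using that comm by (intro adjacent_if_coprime_ord[OF fin]) (auto simp: primes_coprime)
  fix v w assume vw: "v \<in> carrier G" "w \<in> carrier G" "prime (ord v)" "prime (ord w)"
    "odd (ord v)" "odd (ord w)"
  obtain t where t: "t \<in> carrier G" "prime (ord t)" "odd (ord t)" "ord t \<noteq> ord v"
    using a b ne by metis
  show "(v, w) \<in> (parcs (difference_graph G))\<^sup>*"
  proof (cases "ord v = ord w")
    case True
    then have "(v, t) \<in> parcs (difference_graph G)" "(t, w) \<in> parcs (difference_graph G)"
      using * vw t by metis+
    then show ?thesis by auto
  next
    case False
    then show ?thesis using * vw by blast
  qed
qed

end

section \<open>Powers, prime orders and central involutions in a dihedral group\<close>

lemma one_dihedral [simp]: "\<one>\<^bsub>dihedral n\<^esub> = (0, False)"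
  by (simp add: dihedral_def)

lemma finite_dihedral [simp]: "finite (carrier (dihedral n))"
  by (simp add: dihedral_def)

lemma rotation_pow_dihedral [simp]:
  "(i, False) [^]\<^bsub>dihedral n\<^esub> (k::nat) = (int k * i mod int n, False)"
proof (induction k)
  case (Suc k)
  then show ?case by (simp add: dihedral_def mod_simps algebra_simps)
qed simp

lemma reflection_pow_dihedral [simp]:
  "(i, True) [^]\<^bsub>dihedral n\<^esub> (k::nat) = (if even k then (0, False) else (i mod int n, True))"
proof (induction k)
  case (Suc k)
  then show ?case by (simp add: dihedral_def mod_simps)
qed simp

lemma nat_pow_DirProd:
  "(x, y) [^]\<^bsub>G \<times>\<times> H\<^esub> (k::nat) = (x [^]\<^bsub>G\<^esub> k, y [^]\<^bsub>H\<^esub> k)"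
  by (induction k) simp_all

lemma dihedral_exists_prime_order:
  assumes "prime q" "q dvd n" "n \<ge> 1"
  shows "\<exists>x \<in> carrier (dihedral n). x \<noteq> \<one>\<^bsub>dihedral n\<^esub> \<and> x [^]\<^bsub>dihedral n\<^esub> q = \<one>\<^bsub>dihedral n\<^esub>"
proof -
  obtain k where k: "n = q * k" using assms by blast
  have "q > 1" "k > 0" using assms k prime_gt_1_nat by auto
  \<comment> \<open>The witness is the rotation \<open>r ^ (n div q)\<close>.\<close>
  then show ?thesis
    by (intro bexI[of _ "(int k, False)"]) (simp_all add: k, simp add: dihedral_def)
qed

lemma dihedral_exists_central_involution:
  assumes "n = 1 \<or> even n" "n \<ge> 1"
  shows "\<exists>c \<in> carrier (dihedral n). c \<noteq> \<one>\<^bsub>dihedral n\<^esub> \<and>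
    c \<otimes>\<^bsub>dihedral n\<^esub> c = \<one>\<^bsub>dihedral n\<^esub> \<and>
    (\<forall>x \<in> carrier (dihedral n). c \<otimes>\<^bsub>dihedral n\<^esub> x = x \<otimes>\<^bsub>dihedral n\<^esub> c)"
proof (cases "n = 1")
  case True
  then show ?thesis by (intro bexI[of _ "(0, True)"]) (auto simp: dihedral_def)
next
  case False
  then obtain k where k: "n = 2 * k" "k > 0" using assms by auto
  \<comment> \<open>The half turn \<open>r ^ k\<close> commutes with reflections because
    \<open>k\<close> and \<open>-k\<close> agree modulo \<open>2 * k\<close>.\<close>
  have "(i + int k) mod (2 * int k) = (i - int k) mod (2 * int k)" for i
    by (simp add: mod_eq_dvd_iff)
  with k show ?thesis
    by (intro bexI[of _ "(int k, False)"]) (auto simp: dihedral_def algebra_simps)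
qed

section \<open>The product of two dihedral groups\<close>

locale dihedral_product =
  fixes n m :: nat
  assumes n: "n \<ge> 1" and m: "m \<ge> 1"
begin

abbreviation "G \<equiv> dihedral n \<times>\<times> dihedral m"

sublocale Dn: group "dihedral n"
  using n by (rule group_dihedral)

sublocale Dm: group "dihedral m"
  using m by (rule group_dihedral)

sublocale group G
  by (intro DirProd_group Dn.group_axioms Dm.group_axioms)

lemma finite_carrier: "finite (carrier G)"
  by simp

text \<open>Odd powers of a reflection are reflections, so a reflection in either coordinate would
  keep the power \<open>ord x\<close> of \<open>x\<close> from being the identity.\<close>

lemma odd_ord_is_rotation:
  assumes "x \<in> carrier G" "odd (ord x)"
  obtains i j where "x = ((i, False), (j, False))"
proof -
  obtain i e j f where x: "x = ((i, e), (j, f))"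
    by (metis surj_pair)
  have "x [^]\<^bsub>G\<^esub> ord x = \<one>\<^bsub>G\<^esub>"
    using assms(1) by (rule pow_ord_eq_1)
  then have "\<not> e" "\<not> f"
    using assms(2) by (auto simp: x nat_pow_DirProd)
  then show ?thesis
    using that x by simp
qed

lemma odd_ord_commute:
  assumes "x \<in> carrier G" "y \<in> carrier G" "odd (ord x)" "odd (ord y)"
  shows "x \<otimes>\<^bsub>G\<^esub> y = y \<otimes>\<^bsub>G\<^esub> x"
proof -
  obtain i j i' j' where "x = ((i, False), (j, False))" "y = ((i', False), (j', False))"
    using assms odd_ord_is_rotation by metis
  then show ?thesis
    by (simp add: dihedral_def add.commute)
qed

lemma exists_ord_prime:
  assumes "prime q" "q dvd n \<or> q dvd m"
  shows "\<exists>x \<in> carrier G. ord x = q"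
  using assms(2)
proof
  assume "q dvd n"
  then obtain x where "x \<in> carrier (dihedral n)" "x \<noteq> \<one>\<^bsub>dihedral n\<^esub>"
    "x [^]\<^bsub>dihedral n\<^esub> q = \<one>\<^bsub>dihedral n\<^esub>"
    using dihedral_exists_prime_order assms(1) n by blast
  then have "ord (x, \<one>\<^bsub>dihedral m\<^esub>) = q"
    using assms(1) Dm.one_closed Dm.nat_pow_one
    by (intro ord_eq_prime) (simp_all add: nat_pow_DirProd)
  then show ?thesis
    using \<open>x \<in> _\<close> Dm.one_closed by (metis SigmaI carrier_DirProd)
next
  assume "q dvd m"
  then obtain x where "x \<in> carrier (dihedral m)" "x \<noteq> \<one>\<^bsub>dihedral m\<^esub>"
    "x [^]\<^bsub>dihedral m\<^esub> q = \<one>\<^bsub>dihedral m\<^esub>"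
    using dihedral_exists_prime_order assms(1) m by blast
  then have "ord (\<one>\<^bsub>dihedral n\<^esub>, x) = q"
    using assms(1) Dn.one_closed Dn.nat_pow_one
    by (intro ord_eq_prime) (simp_all add: nat_pow_DirProd)
  then show ?thesis
    using \<open>x \<in> _\<close> Dn.one_closed by (metis SigmaI carrier_DirProd)
qed

text \<open>One factor contributes a central involution; the identity in the other coordinate keeps
  it central.\<close>

lemma exists_central_involution:
  assumes "n = 1 \<or> even n \<or> m = 1 \<or> even m"
  shows "\<exists>c \<in> carrier G. c \<noteq> \<one>\<^bsub>G\<^esub> \<and> c \<otimes>\<^bsub>G\<^esub> c = \<one>\<^bsub>G\<^esub> \<and>
    (\<forall>x \<in> carrier G. c \<otimes>\<^bsub>G\<^esub> x = x \<otimes>\<^bsub>G\<^esub> c)"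
proof -
  consider "n = 1 \<or> even n" | "m = 1 \<or> even m" using assms by blast
  then show ?thesis
  proof cases
    case 1
    obtain c where c: "c \<in> carrier (dihedral n)" "c \<noteq> \<one>\<^bsub>dihedral n\<^esub>"
      "c \<otimes>\<^bsub>dihedral n\<^esub> c = \<one>\<^bsub>dihedral n\<^esub>"
      and central: "\<forall>x \<in> carrier (dihedral n). c \<otimes>\<^bsub>dihedral n\<^esub> x = x \<otimes>\<^bsub>dihedral n\<^esub> c"
      using dihedral_exists_central_involution[OF 1 n] by blast
    show ?thesis
    proof (intro bexI[of _ "(c, \<one>\<^bsub>dihedral m\<^esub>)"] conjI ballI)
      fix x assume "x \<in> carrier G"
      then show "(c, \<one>\<^bsub>dihedral m\<^esub>) \<otimes>\<^bsub>G\<^esub> x = x \<otimes>\<^bsub>G\<^esub> (c, \<one>\<^bsub>dihedral m\<^esub>)"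
        using central by (cases x) (simp del: one_dihedral)
    qed (use c in \<open>simp_all del: one_dihedral\<close>)
  next
    case 2
    obtain c where c: "c \<in> carrier (dihedral m)" "c \<noteq> \<one>\<^bsub>dihedral m\<^esub>"
      "c \<otimes>\<^bsub>dihedral m\<^esub> c = \<one>\<^bsub>dihedral m\<^esub>"
      and central: "\<forall>x \<in> carrier (dihedral m). c \<otimes>\<^bsub>dihedral m\<^esub> x = x \<otimes>\<^bsub>dihedral m\<^esub> c"
      using dihedral_exists_central_involution[OF 2 m] by blast
    show ?thesis
    proof (intro bexI[of _ "(\<one>\<^bsub>dihedral n\<^esub>, c)"] conjI ballI)
      fix x assume "x \<in> carrier G"
      then show "(\<one>\<^bsub>dihedral n\<^esub>, c) \<otimes>\<^bsub>G\<^esub> x = x \<otimes>\<^bsub>G\<^esub> (\<one>\<^bsub>dihedral n\<^esub>, c)"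
        using central by (cases x) (simp del: one_dihedral)
    qed (use c in \<open>simp_all del: one_dihedral\<close>)
  qed
qed

section \<open>Disconnectedness forces powers of one odd prime\<close>

lemma disconnected_imp_odd_prime_powers:
  assumes disc: "disconnected (difference_graph G)"
  shows "\<exists>p a b :: nat. prime p \<and> odd p \<and> a \<ge> 1 \<and> b \<ge> 1 \<and> n = p ^ a \<and> m = p ^ b"
proof -
  have "\<not> (n = 1 \<or> even n \<or> m = 1 \<or> even m)"
    using disc exists_central_involution
      not_disconnected_if_central_involution[OF finite_carrier] by metis
  then have ne: "n \<noteq> 1" "m \<noteq> 1" and odd: "odd n" "odd m"
    by auto
  obtain p where p: "prime p" "p dvd n"
    using prime_factor_nat[OF ne(1)] by blast
  \<comment> \<open>A second prime factor of \<open>n\<close> or \<open>m\<close> would be odd as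
    well, giving elements of two different odd prime orders in \<open>G\<close>.\<close>
  have unique: "q = p" if q: "prime q" "q dvd n \<or> q dvd m" for q
  proof (rule ccontr)
    assume "q \<noteq> p"
    obtain a b where "a \<in> carrier G" "ord a = p" "b \<in> carrier G" "ord b = q"
      using exists_ord_prime p q by metis
    moreover have "odd p" "odd q"
      using p q odd by auto
    ultimately show False
      using disc \<open>q \<noteq> p\<close> p q
        not_disconnected_if_two_odd_primes[OF finite_carrier odd_ord_commute, of a b] by simp
  qed
  have "\<exists>k. l = p ^ k" if "l = n \<or> l = m" for l
  proof (rule ccontr)
    assume "\<nexists>k. l = p ^ k"
    moreover have "l \<noteq> 0"
      using that n m by auto
    ultimately obtain q where "prime q" "q dvd l" "q \<noteq> p"
      using Ex_other_prime_factor[of l p] p(1) by auto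
    then show False
      using unique that by blast
  qed
  then obtain a b where "n = p ^ a" "m = p ^ b"
    by blast
  \<comment> \<open>Exponent 0 would make the number 1, which is already excluded.\<close>
  moreover from this have "a \<ge> 1" "b \<ge> 1"
    using ne by (metis less_one not_le power_0)+
  moreover have "odd p"
    using p odd by auto
  ultimately show ?thesis
    using p(1) by blast
qed

section \<open>An edge invariant separating two components\<close>

text \<open>
  If \<open>n\<close> and \<open>m\<close> are powers of one odd prime, the vertices with this property are those that are
  powers of a pair of a reflection and a rotation, in this order.
\<close>
definition in_left_component :: "(int \<times> bool) \<times> (int \<times> bool) \<Rightarrow> bool" where
  "in_left_component x \<longleftrightarrow> \<not> snd (snd x) \<and> (snd (fst x) \<or> fst x = (0, False))"

text \<open>Both ends of an edge are powers of one \<open>z\<close>. Their orders are incomparable,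
  whereas divisors of a prime power form a chain, so \<open>ord z\<close> is no prime power. Hence
  \<open>z\<close> pairs a reflection with a rotation.\<close>

lemma in_left_component_step:
  assumes p: "prime p" "n = p ^ a" "m = p ^ b"
    and gh: "(g, h) \<in> parcs (difference_graph G)" and g: "in_left_component g"
  shows "in_left_component h"
proof -
  obtain z where z: "z \<in> carrier G" "g \<in> generate G {z}" "h \<in> generate G {z}"
    and incomp: "\<not> ord g dvd ord h" "\<not> ord h dvd ord g"
    using gh adjacent_iff_ord[OF finite_carrier] by blast
  have "ord z \<noteq> 0"
    using ord_ge_1[OF finite_carrier z(1)] by simp
  then obtain k l where k: "g = z [^]\<^bsub>G\<^esub> (k::nat)" and l: "h = z [^]\<^bsub>G\<^esub> (l::nat)"
    using z(2,3) by (auto simp: generate_pow_nat[OF z(1)])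
  have no_primepow: "z [^]\<^bsub>G\<^esub> (q ^ c) \<noteq> \<one>\<^bsub>G\<^esub>" if "prime q" for q c :: nat
  proof
    assume "z [^]\<^bsub>G\<^esub> (q ^ c) = \<one>\<^bsub>G\<^esub>"
    then have "ord z dvd q ^ c"
      using z(1) by (simp only: pow_eq_id)
    then have "ord g dvd q ^ c" "ord h dvd q ^ c"
      using z ord_dvd_of_in_generate dvd_trans by blast+
    then show False
      using primepow_divisors_comparable[OF that] incomp by blast
  qed
  \<comment> \<open>The identity satisfies \<open>in_left_component\<close> without being a vertex;
    the last case needs it excluded.\<close>
  have g1: "g \<noteq> \<one>\<^bsub>G\<^esub>"
    using incomp by (metis ord_id one_dvd)
  obtain i e j f where zeq: "z = ((i, e), (j, f))"
    by (metis surj_pair)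
  consider "e" "f" | "\<not> e" "\<not> f" | "e" "\<not> f" | "\<not> e" "f" by blast
  then show ?thesis
  proof cases
    case 1
    then show ?thesis
      using no_primepow[of 2 1] by (simp add: zeq nat_pow_DirProd)
  next
    \<comment> \<open>A pair of rotations is killed by \<open>n * m = p ^ (a + b)\<close>; here it
      matters that both numbers are powers of the same prime.\<close>
    case 2
    then show ?thesis
      using no_primepow[OF p(1), of "a + b"] p by (simp add: zeq nat_pow_DirProd power_add)
  next
    case 3
    then show ?thesis
      by (simp add: l zeq nat_pow_DirProd in_left_component_def)
  next
    \<comment> \<open>\<open>in_left_component g\<close> forces \<open>k\<close> to be even and the
      first coordinate to be trivial, so \<open>g\<close> would be the identity.\<close>
    case 4
    then show ?thesis
      using g g1 by (auto simp: k zeq nat_pow_DirProd in_left_component_def split: if_splits)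
  qed
qed

lemma odd_prime_powers_imp_disconnected:
  assumes p: "prime p" "odd p" "a \<ge> 1" "b \<ge> 1" "n = p ^ a" "m = p ^ b"
  shows "disconnected (difference_graph G)"
proof -
  let ?E = "parcs (difference_graph G)"
  have gt: "n > 1" "m > 1"
    using p prime_gt_1_nat[OF p(1)] by (simp_all add: one_less_power Suc_le_eq del: One_nat_def)
  have odd: "odd n" "odd m"
    using p by auto
  have adj: "(s, r) \<in> ?E"
    if "s \<in> carrier G" "r \<in> carrier G" "s \<noteq> \<one>\<^bsub>G\<^esub>" "r \<noteq> \<one>\<^bsub>G\<^esub>" "s \<otimes>\<^bsub>G\<^esub> r = r \<otimes>\<^bsub>G\<^esub> s"
      "s [^]\<^bsub>G\<^esub> (2::nat) = \<one>\<^bsub>G\<^esub>" "r [^]\<^bsub>G\<^esub> (n * m) = \<one>\<^bsub>G\<^esub>" for s r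
  proof -
    have "ord s dvd 2" "ord r dvd n * m"
      using that pow_eq_id by blast+
    moreover have "coprime 2 (n * m)"
      using odd by simp
    ultimately have "coprime (ord s) (ord r)"
      by (rule coprime_divisors)
    then show ?thesis
      using that by (intro adjacent_if_coprime_ord[OF finite_carrier])
  qed
  \<comment> \<open>A reflection in a single factor, once on each side of the invariant.\<close>
  define u where "u = ((0::int, True), (0::int, False))"
  define v where "v = ((0::int, False), (0::int, True))"
  \<comment> \<open>The neighbour is the generating rotation of the other factor, nontrivial since
    \<open>n\<close> and \<open>m\<close> exceed 1.\<close>
  have "(u, ((0, False), (1, False))) \<in> ?E" "(v, ((1, False), (0, False))) \<in> ?E"
    using gt by (intro adj; simp add: u_def v_def nat_pow_DirProd; simp add: dihedral_def)+
  then have "u \<in> pverts (difference_graph G)" "v \<in> pverts (difference_graph G)"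
    unfolding vertex_difference_graph_iff by blast+
  moreover have "(u, v) \<notin> ?E\<^sup>*"
  proof
    assume "(u, v) \<in> ?E\<^sup>*"
    then have "in_left_component v"
    proof (induction rule: rtrancl_induct)
      case base
      show ?case by (simp add: u_def in_left_component_def)
    qed (use in_left_component_step p in blast)
    then show False
      by (simp add: v_def in_left_component_def)
  qed
  ultimately show ?thesis
    using disconnected_difference_graph_iff[OF finite_carrier] by blast
qed

end

theorem theorem6p4:
  fixes n m :: nat
  assumes "n \<ge> 1" and "m \<ge> 1"
  shows "disconnected (difference_graph (dihedral n \<times>\<times> dihedral m)) \<longleftrightarrow>
    (\<exists>p a b :: nat. prime p \<and> odd p \<and> a \<ge> 1 \<and> b \<ge> 1 \<and> n = p ^ a \<and> m = p ^ b)"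
proof -
  interpret dihedral_product n m
    using assms by unfold_locales
  show ?thesis
    using disconnected_imp_odd_prime_powers odd_prime_powers_imp_disconnected by blast
qed

end
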